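(* Let $\mathcal H,\mathcal G$ be Hilbert spaces, let $\mathcal D\subset\mathcal G$ be nonempty, let $I_1=\{1,\dots,m\}$, $I_2=\{m+1,\dots,n\}$, and let $f_i:\mathcal D\to\mathbb R$, $g_i:\mathcal D\to\mathcal H$, $i\in I_1\cup I_2$, be Lipschitz on $\mathcal D$. Let $\mathbb C:\mathcal D\rightrightarrows\mathcal H$ be the multifunction $\mathbb C(p)=C(p)$, where $$C(p)=\{x\in\mathcal H \mid \langle x\mid g_i(p)\rangle=f_i(p),\ i\in I_1,\ \ \langle x\mid g_i(p)\rangle\le f_i(p),\ i\in I_2\}.$$ Let $\bar p\in\mathcal D$, $\bar x\in C(\bar p)$ and $\bar x\in\liminf_{p\to\bar p}\mathbb C(p)$. Assume that there exist numbers $M>0$, $\delta_1>0$, $\delta_2>0$ such that $$\Lambda_w^M(p,P_{C(p)}(w))=\Big\{\lambda\in\Lambda_w(p,P_{C(p)}(w))\ \Big|\ \sum_{i=1}^n|\lambda_i|\le M\Big\}\neq\emptyset$$ for all $p\in(\bar p+\delta_1B)\cap\mathcal D$ and all $w\in\bar x+\delta_2B$, $w\notin C(p)$. Then the multifunction $\mathbb C$ is $R$-regular at $(\bar p,\bar x)$.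
   Context: Hilbert spaces are real, with inner product $\langle\cdot\mid\cdot\rangle$; $B$ denotes the open unit ball of the space in question. Neighbourhoods of $\bar p$ are understood relative to $\mathcal D$. Lower limit: $\liminf_{p\to\bar p}\mathbb C(p)=\{y\in\mathcal H\mid \forall\,p_k\to\bar p\ (p_k\in\mathcal D)\ \exists\,y_k\in\mathbb C(p_k),\ y_k\to y\}$; equivalently, $\bar x$ belongs to it iff for every neighbourhood $V(\bar x)$ of $\bar x$ there is a neighbourhood $U(\bar p)$ of $\bar p$ such that $\mathbb C(p)\cap V(\bar x)\neq\emptyset$ for all $p\in U(\bar p)$. Projection: $P_{C(p)}(w)=\arg\min_{x\in C(p)}\|w-x\|$ (the unique nearest point of the closed convex set $C(p)$, when $C(p)\ne\emptyset$; the condition $\Lambda_w^M(p,P_{C(p)}(w))\ne\emptyset$ presupposes $C(p)\neq\emptyset$). Lagrange multipliers: put $G_i(x,p)=\langle x\mid g_i(p)\rangle-f_i(p)$ and, for $\lambda\in\mathbb R^n$, $L_w(p,x,\lambda)=\|x-w\|+\sum_{i=1}^n\lambda_iG_i(x,p)$. Then $$\Lambda_w(p,x)=\{\lambda\in\mathbb R^n\mid \nabla_xL_w(p,x,\lambda)=0,\ \lambda_i\ge0\text{ and }\lambda_iG_i(x,p)=0\text{ for } i\in I_2\}.$$ For $w\notin C(p)$ and $x=P_{C(p)}(w)$, $\nabla_xL_w(p,x,\lambda)=\frac{P_{C(p)}(w)-w}{\|P_{C(p)}(w)-w\|}+\sum_{i=1}^n\lambda_ig_i(p)$. $R$-regularity: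 $\mathbb C$ is $R$-regular at $(\bar p,\bar x)$ if there is $\alpha>0$ such that for all $(p,x)$ in a neighbourhood of $(\bar p,\bar x)$ in $\mathcal D\times\mathcal H$, $$\operatorname{dist}(x,\mathbb C(p))\le\alpha\max\{0,\ |\langle x\mid g_i(p)\rangle-f_i(p)|,\ i\in I_1,\ \ \langle x\mid g_i(p)\rangle-f_i(p),\ i\in I_2\},$$ where $\operatorname{dist}(x,A)=\inf_{a\in A}\|x-a\|$ (with $\operatorname{dist}(x,\emptyset)=+\infty$). *)

theory Defs
  imports "HOL-Analysis.Analysis"
begin

text \<open>Constraint systems are given by families \<open>f\<close>, \<open>g\<close> indexed by naturals; the indices in
  \<open>{1..m}\<close> are equalities, those in \<open>{m+1..n}\<close> are inequalities.\<close>

definition constr :: "(nat \<Rightarrow> 'g \<Rightarrow> real) \<Rightarrow> (nat \<Rightarrow> 'g \<Rightarrow> 'h::real_inner) \<Rightarrow> nat \<Rightarrow> 'h \<Rightarrow> 'g \<Rightarrow> real" where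
  "constr f g i x p = inner x (g i p) - f i p"

definition feasible_set ::
  "nat \<Rightarrow> nat \<Rightarrow> (nat \<Rightarrow> 'g \<Rightarrow> real) \<Rightarrow> (nat \<Rightarrow> 'g \<Rightarrow> 'h::real_inner) \<Rightarrow> 'g \<Rightarrow> 'h set" where
  "feasible_set m n f g p =
     {x. (\<forall>i\<in>{1..m}. inner x (g i p) = f i p) \<and> (\<forall>i\<in>{m+1..n}. inner x (g i p) \<le> f i p)}"

text \<open>The selection \<open>y\<^sub>k \<in> C p\<^sub>k\<close> is required for all large \<open>k\<close> only, so that values of \<open>C\<close> far
  away from \<open>pbar\<close> are irrelevant; see \<open>lower_limit_iff\<close>.\<close>

definition lower_limit ::
  "'g::metric_space set \<Rightarrow> ('g \<Rightarrow> 'h::metric_space set) \<Rightarrow> 'g \<Rightarrow> 'h set" where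
  "lower_limit D C pbar =
     {y. \<forall>p. (\<forall>k. p k \<in> D) \<and> p \<longlonglongrightarrow> pbar \<longrightarrow>
           (\<exists>v. (\<forall>\<^sub>F k in sequentially. v k \<in> C (p k)) \<and> v \<longlonglongrightarrow> y)}"

lemma lower_limit_iff:
  fixes D :: "'g::metric_space set" and C :: "'g \<Rightarrow> 'h::metric_space set"
  shows "y \<in> lower_limit D C pbar \<longleftrightarrow>
    (\<forall>V. open V \<and> y \<in> V \<longrightarrow> (\<exists>U. open U \<and> pbar \<in> U \<and> (\<forall>p\<in>U \<inter> D. C p \<inter> V \<noteq> {})))"
proof
  assume y: "y \<in> lower_limit D C pbar"
  show "\<forall>V. open V \<and> y \<in> V \<longrightarrow> (\<exists>U. open U \<and> pbar \<in> U \<and> (\<forall>p\<in>U \<inter> D. C p \<inter> V \<noteq> {}))"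
  proof (intro allI impI, rule ccontr)
    fix V assume V: "open V \<and> y \<in> V"
      and no: "\<nexists>U. open U \<and> pbar \<in> U \<and> (\<forall>p\<in>U \<inter> D. C p \<inter> V \<noteq> {})"
    have "\<exists>q. q \<in> ball pbar (inverse (real (Suc k))) \<and> q \<in> D \<and> C q \<inter> V = {}" for k
    proof -
      have "open (ball pbar (inverse (real (Suc k))))" "pbar \<in> ball pbar (inverse (real (Suc k)))"
        by simp_all
      then show ?thesis using no by blast
    qed
    then obtain q where q: "\<And>k. q k \<in> ball pbar (inverse (real (Suc k)))"
      "\<And>k. q k \<in> D" "\<And>k. C (q k) \<inter> V = {}" by metis
    have "(\<lambda>k. dist (q k) pbar) \<longlonglongrightarrow> 0"
    proof (rule tendsto_sandwich[OF _ _ tendsto_const LIMSEQ_inverse_real_of_nat])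
      show "\<forall>\<^sub>F k in sequentially. 0 \<le> dist (q k) pbar" by simp
      show "\<forall>\<^sub>F k in sequentially. dist (q k) pbar \<le> inverse (real (Suc k))"
        using q(1) by (intro always_eventually allI) (metis dist_commute less_imp_le mem_ball)
    qed
    then have "q \<longlonglongrightarrow> pbar" by (rule iffD2[OF tendsto_dist_iff])
    then obtain v where v: "\<forall>\<^sub>F k in sequentially. v k \<in> C (q k)" "v \<longlonglongrightarrow> y"
      using y q(2) unfolding lower_limit_def by blast
    have "\<forall>\<^sub>F k in sequentially. v k \<in> V" using V topological_tendstoD[OF v(2)] by blast
    with v(1) have "\<forall>\<^sub>F k in sequentially. False"
      by eventually_elim (use q(3) in blast)
    then show False by simp
  qed
next
  assume nb: "\<forall>V. open V \<and> y \<in> V \<longrightarrow> (\<exists>U. open U \<and> pbar \<in> U \<and> (\<forall>p\<in>U \<inter> D. C p \<inter> V \<noteq> {}))"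
  show "y \<in> lower_limit D C pbar"
    unfolding lower_limit_def mem_Collect_eq
  proof (intro allI impI)
    fix p assume p: "(\<forall>k. p k \<in> D) \<and> p \<longlonglongrightarrow> pbar"
    define near where "near k j \<longleftrightarrow> C (p k) \<inter> ball y (inverse (real (Suc j))) \<noteq> {}" for k j
    have ev: "\<forall>\<^sub>F k in sequentially. near k j" for j
    proof -
      have "open (ball y (inverse (real (Suc j)))) \<and> y \<in> ball y (inverse (real (Suc j)))" by simp
      then obtain U where U: "open U" "pbar \<in> U"
        "\<forall>p\<in>U \<inter> D. C p \<inter> ball y (inverse (real (Suc j))) \<noteq> {}" using nb by blast
      have "\<forall>\<^sub>F k in sequentially. p k \<in> U" using p U(1,2) topological_tendstoD[of p pbar sequentially U] by blast
      then show ?thesis by eventually_elim (use U(3) p in \<open>auto simp: near_def\<close>)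
    qed
    have mono: "near k i" if "near k j" "i \<le> j" for k i j
    proof -
      have "inverse (real (Suc j)) \<le> inverse (real (Suc i))" using that(2) by simp
      then have "ball y (inverse (real (Suc j))) \<subseteq> ball y (inverse (real (Suc i)))"
        by (rule subset_ball)
      then show ?thesis using that(1) unfolding near_def by blast
    qed
    define J where "J k = (if near k 0 then Max {j. j \<le> k \<and> near k j} else 0)" for k
    have J: "near k (J k)" if "near k 0" for k
    proof -
      have "Max {j. j \<le> k \<and> near k j} \<in> {j. j \<le> k \<and> near k j}"
        by (rule Max_in) (use that in auto)
      then show ?thesis using that by (simp add: J_def)
    qed
    have J_ge: "j \<le> J k" if "near k j" "j \<le> k" for j k
      using that mono[OF that(1), of 0] by (auto simp: J_def intro!: Max_ge)
    have "\<exists>v. near k 0 \<longrightarrow> v \<in> C (p k) \<and> dist y v < inverse (real (Suc (J k)))" for k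
      using J[of k] unfolding near_def[of k "J k"] disjoint_iff mem_ball by blast
    then obtain v where
      v: "\<And>k. near k 0 \<Longrightarrow> v k \<in> C (p k) \<and> dist y (v k) < inverse (real (Suc (J k)))"
      by metis
    have "\<forall>\<^sub>F k in sequentially. v k \<in> C (p k)"
      using ev[of 0] by eventually_elim (use v in blast)
    moreover have "v \<longlonglongrightarrow> y"
    proof (rule tendstoI)
      fix e :: real assume "e > 0"
      then obtain j where j: "inverse (real (Suc j)) < e" using reals_Archimedean by blast
      show "\<forall>\<^sub>F k in sequentially. dist (v k) y < e"
        using ev[of j] eventually_ge_at_top[of j]
      proof eventually_elim
        case (elim k)
        have le: "inverse (real (Suc (J k))) \<le> inverse (real (Suc j))"
          using J_ge[OF elim] by simp
        have "near k 0" using mono[OF elim(1), of 0] by simp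
        then have "dist y (v k) < e" using v[of k] le j by linarith
        then show ?case by (simp only: dist_commute)
      qed
    qed
    ultimately show "\<exists>v. (\<forall>\<^sub>F k in sequentially. v k \<in> C (p k)) \<and> v \<longlonglongrightarrow> y" by blast
  qed
qed

text \<open>The library's \<^const>\<open>closest_point\<close> is restricted to \<^class>\<open>heine_borel\<close> spaces, hence to
  finite dimension. The value on the empty set is unspecified.\<close>

definition projection :: "'h::real_normed_vector set \<Rightarrow> 'h \<Rightarrow> 'h" where
  "projection S w = arg_min_on (\<lambda>x. norm (w - x)) S"

definition lagrangian ::
  "nat \<Rightarrow> (nat \<Rightarrow> 'g \<Rightarrow> real) \<Rightarrow> (nat \<Rightarrow> 'g \<Rightarrow> 'h::real_inner) \<Rightarrow> 'h \<Rightarrow> 'g \<Rightarrow> 'h \<Rightarrow> (nat \<Rightarrow> real) \<Rightarrow> real" where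
  "lagrangian n f g w p x \<mu> = norm (x - w) + (\<Sum>i=1..n. \<mu> i * constr f g i x p)"

definition multipliers ::
  "nat \<Rightarrow> nat \<Rightarrow> (nat \<Rightarrow> 'g \<Rightarrow> real) \<Rightarrow> (nat \<Rightarrow> 'g \<Rightarrow> 'h::real_inner) \<Rightarrow> 'h \<Rightarrow> 'g \<Rightarrow> 'h \<Rightarrow> (nat \<Rightarrow> real) set" where
  "multipliers m n f g w p x =
     {\<mu> \<in> {1..n} \<rightarrow>\<^sub>E UNIV. (GDERIV (\<lambda>y. lagrangian n f g w p y \<mu>) x :> 0) \<and>
        (\<forall>i\<in>{m+1..n}. 0 \<le> \<mu> i \<and> \<mu> i * constr f g i x p = 0)}"

definition bounded_multipliers ::
  "nat \<Rightarrow> nat \<Rightarrow> (nat \<Rightarrow> 'g \<Rightarrow> real) \<Rightarrow> (nat \<Rightarrow> 'g \<Rightarrow> 'h::real_inner) \<Rightarrow> real \<Rightarrow> 'h \<Rightarrow> 'g \<Rightarrow> 'h \<Rightarrow> (nat \<Rightarrow> real) set" where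
  "bounded_multipliers m n f g M w p x =
     {\<mu> \<in> multipliers m n f g w p x. (\<Sum>i=1..n. \<bar>\<mu> i\<bar>) \<le> M}"

text \<open>Unlike \<^const>\<open>infdist\<close>, which is \<open>0\<close> on the empty set, this is \<open>\<infinity>\<close> there.\<close>

definition set_dist :: "'h::real_normed_vector \<Rightarrow> 'h set \<Rightarrow> ereal" where
  "set_dist x A = (INF a\<in>A. ereal (norm (x - a)))"

lemma set_dist_empty: "set_dist x {} = \<infinity>"
  by (simp add: set_dist_def top_ereal_def)

definition R_regular ::
  "'g::topological_space set \<Rightarrow> nat \<Rightarrow> nat \<Rightarrow> (nat \<Rightarrow> 'g \<Rightarrow> real) \<Rightarrow> (nat \<Rightarrow> 'g \<Rightarrow> 'h::real_inner) \<Rightarrow> 'g \<Rightarrow> 'h \<Rightarrow> bool" where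
  "R_regular D m n f g pbar xbar \<longleftrightarrow>
     (\<exists>\<alpha>>0. \<exists>U. openin (top_of_set (D \<times> UNIV)) U \<and> (pbar, xbar) \<in> U \<and>
        (\<forall>(p, x)\<in>U. set_dist x (feasible_set m n f g p) \<le>
           ereal (\<alpha> * Max ({0} \<union> (\<lambda>i. \<bar>inner x (g i p) - f i p\<bar>) ` {1..m}
                             \<union> (\<lambda>i. inner x (g i p) - f i p) ` {m+1..n}))))"

end

theory Submission imports Defs begin

text \<open>
  Fix \<open>p\<close> near \<open>pbar\<close> and an infeasible \<open>w\<close> near \<open>xbar\<close>. The Lagrangian
  \<open>y \<mapsto> \<parallel>y - w\<parallel> + \<Sum>\<^sub>i \<mu>\<^sub>i G\<^sub>i(y)\<close> is the distance to \<open>w\<close> plus an affine function. Pairing the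
  stationarity condition at the projection \<open>x\<close> of \<open>w\<close> with \<open>x - w\<close> therefore gives an exact identity,
  \<open>\<parallel>x - w\<parallel> = \<Sum>\<^sub>i \<mu>\<^sub>i (G\<^sub>i(w) - G\<^sub>i(x))\<close>. Since \<open>x\<close> is feasible, complementarity cancels every
  \<open>\<mu>\<^sub>i G\<^sub>i(x)\<close>, so the distance from \<open>w\<close> to the feasible set is at most \<open>\<Sum>\<^sub>i \<mu>\<^sub>i G\<^sub>i(w)\<close>
  (lemma \<open>norm_eq_sum_multipliers\<close>). The signs of the \<open>\<mu>\<^sub>i\<close> bound this by
  \<open>\<Sum>\<^sub>i \<bar>\<mu>\<^sub>i\<bar>\<close> times the largest constraint violation at \<open>w\<close>, and hence \<open>M\<close> serves as the
  regularity constant, uniformly in \<open>p\<close> and \<open>w\<close>.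

  The argument needs the projection to be a point of the feasible set; that is the existence part
  of the Hilbert projection theorem (\<open>nearest_point_exists\<close>).
\<close>

text \<open>The points of \<open>S\<close> whose distance to \<open>w\<close> is within \<open>\<epsilon>\<close> of the infimum form closed sets whose
  diameter shrinks with \<open>\<epsilon>\<close>: midpoints stay in \<open>S\<close>, so by the parallelogram law two such points
  are close to each other. Completeness then puts a point in all of them.\<close>

lemma nearest_point_exists:
  fixes S :: "'h::{real_inner, complete_space} set"
  assumes "S \<noteq> {}" "closed S" "convex S"
  obtains x where "x \<in> S" "\<And>y. y \<in> S \<Longrightarrow> norm (w - x) \<le> norm (w - y)"
proof -
  define d where "d = infdist w S"
  define T where "T k = S \<inter> cball w (d + inverse (real (Suc k)))" for k
  have d_le: "d \<le> norm (w - y)" if "y \<in> S" for y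
    using infdist_le[OF that, of w] by (simp add: d_def dist_norm)
  have d_ge0: "0 \<le> d"
    by (simp add: d_def infdist_nonneg)
  have small: "(dist x y)\<^sup>2 \<le> 4 * (d + inverse (real (Suc k)))\<^sup>2 - 4 * d\<^sup>2"
    if "x \<in> T k" "y \<in> T k" for x y k
  proof -
    have "midpoint x y \<in> S"
      using that convexD_alt[OF \<open>convex S\<close>, of x y "1/2"]
      by (simp add: T_def midpoint_def scaleR_add_right)
    then have "d\<^sup>2 \<le> (norm (w - midpoint x y))\<^sup>2"
      using d_le d_ge0 by (simp add: power_mono)
    moreover have "(norm (w - x))\<^sup>2 \<le> (d + inverse (real (Suc k)))\<^sup>2"
      "(norm (w - y))\<^sup>2 \<le> (d + inverse (real (Suc k)))\<^sup>2"
      using that by (auto simp: T_def dist_norm intro!: power_mono)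
    moreover have "(dist x y)\<^sup>2
        = 2 * (norm (w - x))\<^sup>2 + 2 * (norm (w - y))\<^sup>2 - 4 * (norm (w - midpoint x y))\<^sup>2"
    proof -
      have "2 *\<^sub>R (w - midpoint x y) = (w - x) + (w - y)"
        by (simp add: midpoint_def scaleR_diff_right scaleR_2)
      then have "4 * (norm (w - midpoint x y))\<^sup>2 = (norm ((w - x) + (w - y)))\<^sup>2"
        by (simp add: power_mult_distrib flip: \<open>2 *\<^sub>R (w - midpoint x y) = (w - x) + (w - y)\<close>)
      moreover have "dist x y = norm ((w - x) - (w - y))"
        by (simp add: dist_norm norm_minus_commute)
      ultimately show ?thesis
        by (simp only: power2_norm_eq_inner inner_diff inner_add) (simp add: inner_commute)
    qed
    ultimately show ?thesis by linarith
  qed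
  have "\<exists>x. \<forall>k. x \<in> T k"
  proof (rule decreasing_closed_nest[of T])
    show "closed (T k)" for k
      using \<open>closed S\<close> by (simp add: T_def closed_Int)
    show "T k \<noteq> {}" for k
    proof -
      have "infdist w S < d + inverse (real (Suc k))"
        by (simp add: d_def)
      then obtain a where "a \<in> S" "dist w a < d + inverse (real (Suc k))"
        using \<open>S \<noteq> {}\<close> by (auto simp: infdist_def cINF_less_iff)
      then show ?thesis
        by (auto simp: T_def)
    qed
    show "T l \<subseteq> T k" if "k \<le> l" for k l
    proof -
      have "inverse (real (Suc l)) \<le> inverse (real (Suc k))"
        using that by simp
      then show ?thesis
        unfolding T_def by (intro Int_mono subset_cball order_refl) simp
    qed
    show "\<exists>k. \<forall>x\<in>T k. \<forall>y\<in>T k. dist x y < e" if "0 < e" for e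
    proof -
      have "(\<lambda>k. 4 * (d + inverse (real (Suc k)))\<^sup>2 - 4 * d\<^sup>2) \<longlonglongrightarrow> 4 * (d + 0)\<^sup>2 - 4 * d\<^sup>2"
        by (intro tendsto_intros LIMSEQ_inverse_real_of_nat)
      then have "\<forall>\<^sub>F k in sequentially. 4 * (d + inverse (real (Suc k)))\<^sup>2 - 4 * d\<^sup>2 < e\<^sup>2"
        using \<open>0 < e\<close> by (intro order_tendstoD) auto
      then obtain k where "4 * (d + inverse (real (Suc k)))\<^sup>2 - 4 * d\<^sup>2 < e\<^sup>2"
        by (auto simp: eventually_sequentially)
      then have "(dist x y)\<^sup>2 < e\<^sup>2" if "x \<in> T k" "y \<in> T k" for x y
        using small[OF that] by linarith
      then show ?thesis
        using \<open>0 < e\<close> by (meson less_imp_le power_less_imp_less_base)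
    qed
  qed blast
  then obtain x where x: "\<And>k. x \<in> T k"
    by blast
  have "norm (w - x) \<le> d"
  proof (rule LIMSEQ_le_const)
    show "(\<lambda>k. d + inverse (real (Suc k))) \<longlonglongrightarrow> d"
      using tendsto_add[OF tendsto_const LIMSEQ_inverse_real_of_nat, of d] by simp
    show "\<exists>N. \<forall>k\<ge>N. norm (w - x) \<le> d + inverse (real (Suc k))"
      using x by (auto simp: T_def dist_norm)
  qed
  moreover have "x \<in> S"
    using x by (simp add: T_def)
  ultimately show ?thesis
    using that d_le order_trans by blast
qed

text \<open>\<^const>\<open>projection\<close> is a choice among the minimisers, so it is known to lie in \<open>S\<close> only
  because a minimiser exists.\<close>

lemma projection_in_set:
  fixes S :: "'h::{real_inner, complete_space} set"
  assumes "S \<noteq> {}" "closed S" "convex S"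
  shows "projection S w \<in> S"
proof -
  obtain x where x: "x \<in> S" "\<And>y. y \<in> S \<Longrightarrow> norm (w - x) \<le> norm (w - y)"
    using nearest_point_exists[OF assms] by blast
  show ?thesis
    unfolding projection_def arg_min_on_def
    by (rule arg_minI[where P = "\<lambda>y. y \<in> S", OF x(1)]) (use x(2) in \<open>auto simp: not_less\<close>)
qed

lemma feasible_set_eq_Inter:
  "feasible_set m n f g p =
     (\<Inter>i\<in>{1..m}. {x. inner (g i p) x = f i p}) \<inter> (\<Inter>i\<in>{m+1..n}. {x. inner (g i p) x \<le> f i p})"
  by (auto simp: feasible_set_def inner_commute)

lemma closed_feasible_set: "closed (feasible_set m n f g p)"
  unfolding feasible_set_eq_Inter
  by (intro closed_Int closed_INT ballI closed_hyperplane closed_halfspace_le)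

lemma convex_feasible_set: "convex (feasible_set m n f g p)"
  unfolding feasible_set_eq_Inter
  by (intro convex_Int convex_INT convex_hyperplane convex_halfspace_le)

text \<open>The only nonsmooth term is the distance to \<open>w\<close>; away from \<open>w\<close> its gradient is the unit
  vector \<open>sgn (x - w)\<close>, and the rest follows from uniqueness of derivatives.\<close>

lemma lagrangian_stationary:
  assumes "GDERIV (\<lambda>y. lagrangian n f g w p y \<mu>) x :> 0" "x \<noteq> w"
  shows "sgn (x - w) + (\<Sum>i=1..n. \<mu> i *\<^sub>R g i p) = 0"
proof -
  have norm: "((\<lambda>y. norm (y - w)) has_derivative (\<lambda>h. inner h (sgn (x - w)))) (at x)"
  proof -
    have "(norm has_derivative (\<lambda>h. inner h (sgn (x - w)))) (at (x - w))"
      using GDERIV_norm[of "x - w"] \<open>x \<noteq> w\<close> by (simp add: gderiv_def)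
    moreover have "((\<lambda>y. y - w) has_derivative (\<lambda>h. h)) (at x)"
      by (auto intro!: derivative_eq_intros)
    ultimately show ?thesis
      by (rule has_derivative_compose[rotated])
  qed
  have "((\<lambda>y. lagrangian n f g w p y \<mu>) has_derivative
      (\<lambda>h. inner h (sgn (x - w)) + (\<Sum>i=1..n. \<mu> i * inner h (g i p)))) (at x)"
    unfolding lagrangian_def constr_def
    by (rule has_derivative_eq_rhs, (rule derivative_intros norm)+) simp
  then have "GDERIV (\<lambda>y. lagrangian n f g w p y \<mu>) x
      :> sgn (x - w) + (\<Sum>i=1..n. \<mu> i *\<^sub>R g i p)"
    by (simp add: gderiv_def inner_add_right inner_sum_right)
  from has_derivative_unique[OF this[unfolded gderiv_def] assms(1)[unfolded gderiv_def]]
  have "inner h (sgn (x - w) + (\<Sum>i=1..n. \<mu> i *\<^sub>R g i p)) = 0" for h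
    by (metis inner_zero_right)
  then show ?thesis
    using inner_eq_zero_iff by blast
qed

text \<open>The identity behind the error bound: pair stationarity with \<open>x - w\<close>. The terms
  \<open>\<mu>\<^sub>i G\<^sub>i(x)\<close> drop out, by feasibility for the equalities and by complementarity for the
  inequalities.\<close>

lemma norm_eq_sum_multipliers:
  fixes x w :: "'h::real_inner"
  assumes "\<mu> \<in> multipliers m n f g w p x" "x \<in> feasible_set m n f g p" "x \<noteq> w"
  shows "norm (x - w) = (\<Sum>i=1..n. \<mu> i * constr f g i w p)"
proof -
  have cancel: "\<mu> i * constr f g i x p = 0" if "i \<in> {1..n}" for i
  proof (cases "i \<le> m")
    case True
    then show ?thesis
      using assms(2) that by (simp add: feasible_set_def constr_def)
  next
    case False
    then show ?thesis
      using assms(1) that by (simp add: multipliers_def)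
  qed
  have "sgn (x - w) + (\<Sum>i=1..n. \<mu> i *\<^sub>R g i p) = 0"
    using assms(1,3) lagrangian_stationary by (auto simp: multipliers_def)
  then have "inner (x - w) (sgn (x - w)) = inner (x - w) (- (\<Sum>i=1..n. \<mu> i *\<^sub>R g i p))"
    by (metis eq_neg_iff_add_eq_0)
  moreover have "inner (x - w) (sgn (x - w)) = norm (x - w)"
    using \<open>x \<noteq> w\<close> by (simp add: sgn_div_norm power2_norm_eq_inner[symmetric] power2_eq_square)
  moreover have "inner (x - w) (- (\<Sum>i=1..n. \<mu> i *\<^sub>R g i p))
      = (\<Sum>i=1..n. \<mu> i * constr f g i w p - \<mu> i * constr f g i x p)"
    unfolding inner_minus_right inner_sum_right sum_negf[symmetric] constr_def
    by (intro sum.cong refl) (simp add: inner_diff_left algebra_simps)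
  ultimately show ?thesis
    using cancel by simp
qed

definition max_violation ::
  "nat \<Rightarrow> nat \<Rightarrow> (nat \<Rightarrow> 'g \<Rightarrow> real) \<Rightarrow> (nat \<Rightarrow> 'g \<Rightarrow> 'h::real_inner) \<Rightarrow> 'h \<Rightarrow> 'g \<Rightarrow> real" where
  "max_violation m n f g x p =
     Max ({0} \<union> (\<lambda>i. \<bar>inner x (g i p) - f i p\<bar>) ` {1..m}
              \<union> (\<lambda>i. inner x (g i p) - f i p) ` {m+1..n})"

lemma max_violation_nonneg: "0 \<le> max_violation m n f g x p"
  unfolding max_violation_def by (intro Max_ge) auto

text \<open>For an inequality the violation enters without absolute value; it is the sign condition
  \<open>0 \<le> \<mu>\<^sub>i\<close> that still gives an upper bound when the constraint holds strictly at \<open>w\<close>.\<close>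

lemma multiplier_term_le:
  assumes "\<mu> \<in> multipliers m n f g v p x" "i \<in> {1..n}"
  shows "\<mu> i * constr f g i w p \<le> \<bar>\<mu> i\<bar> * max_violation m n f g w p"
proof (cases "i \<le> m")
  case True
  then have "\<bar>constr f g i w p\<bar> \<le> max_violation m n f g w p"
    unfolding max_violation_def constr_def using assms(2) by (intro Max_ge) auto
  then have "\<bar>\<mu> i\<bar> * \<bar>constr f g i w p\<bar> \<le> \<bar>\<mu> i\<bar> * max_violation m n f g w p"
    by (intro mult_left_mono) auto
  then show ?thesis
    by (metis abs_mult abs_ge_self order_trans)
next
  case False
  then have "constr f g i w p \<le> max_violation m n f g w p"
    unfolding max_violation_def constr_def using assms(2) by (intro Max_ge) auto
  moreover have "0 \<le> \<mu> i"
    using False assms by (auto simp: multipliers_def)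
  ultimately show ?thesis
    by (simp add: mult_left_mono)
qed

lemma set_dist_le: "a \<in> A \<Longrightarrow> set_dist x A \<le> ereal (norm (x - a))"
  unfolding set_dist_def by (rule INF_lower)

text \<open>The projection is one feasible point, so its distance to \<open>w\<close> bounds the infimum from above.
  The resulting constant is \<open>M\<close>, whatever \<open>p\<close> and \<open>w\<close> are; this is what makes the error bound
  uniform over a neighbourhood.\<close>

lemma set_dist_feasible_set_le:
  fixes w :: "'h::{real_inner, complete_space}"
  assumes "feasible_set m n f g p \<noteq> {}" "w \<notin> feasible_set m n f g p"
    and "bounded_multipliers m n f g M w p (projection (feasible_set m n f g p) w) \<noteq> {}"
  shows "set_dist w (feasible_set m n f g p) \<le> ereal (M * max_violation m n f g w p)"
proof -
  define x where "x = projection (feasible_set m n f g p) w"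
  have x: "x \<in> feasible_set m n f g p"
    unfolding x_def
    using assms(1) closed_feasible_set convex_feasible_set by (rule projection_in_set)
  obtain \<mu> where \<mu>: "\<mu> \<in> multipliers m n f g w p x" "(\<Sum>i=1..n. \<bar>\<mu> i\<bar>) \<le> M"
    using assms(3) by (auto simp: bounded_multipliers_def x_def)
  have "norm (x - w) = (\<Sum>i=1..n. \<mu> i * constr f g i w p)"
    using \<mu>(1) x assms(2) by (intro norm_eq_sum_multipliers) auto
  also have "\<dots> \<le> (\<Sum>i=1..n. \<bar>\<mu> i\<bar> * max_violation m n f g w p)"
    using \<mu>(1) by (intro sum_mono multiplier_term_le)
  also have "\<dots> \<le> M * max_violation m n f g w p"
    using \<mu>(2) max_violation_nonneg[of m n f g w p] by (simp only: sum_distrib_right[symmetric] mult_right_mono)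
  finally have "norm (w - x) \<le> M * max_violation m n f g w p"
    by (simp add: norm_minus_commute)
  then show ?thesis
    using set_dist_le[OF x, of w] by (meson ereal_less_eq(3) order_trans)
qed

theorem proposition2:
  fixes D :: "'g::{real_inner, complete_space} set"
    and f :: "nat \<Rightarrow> 'g \<Rightarrow> real"
    and g :: "nat \<Rightarrow> 'g \<Rightarrow> 'h::{real_inner, complete_space}"
    and m n :: nat and pbar :: 'g and xbar :: 'h and M \<delta>\<^sub>1 \<delta>\<^sub>2 :: real
  assumes "D \<noteq> {}" and "m \<le> n"
    and "\<forall>i\<in>{1..n}. \<exists>L. L-lipschitz_on D (f i)"
    and "\<forall>i\<in>{1..n}. \<exists>L. L-lipschitz_on D (g i)"
    and "pbar \<in> D" and "xbar \<in> feasible_set m n f g pbar"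
    and "xbar \<in> lower_limit D (feasible_set m n f g) pbar"
    and "M > 0" and "\<delta>\<^sub>1 > 0" and "\<delta>\<^sub>2 > 0"
    and "\<forall>p \<in> ball pbar \<delta>\<^sub>1 \<inter> D. \<forall>w \<in> ball xbar \<delta>\<^sub>2. w \<notin> feasible_set m n f g p \<longrightarrow>
           feasible_set m n f g p \<noteq> {} \<and>
           bounded_multipliers m n f g M w p (projection (feasible_set m n f g p) w) \<noteq> {}"
  shows "R_regular D m n f g pbar xbar"
proof -
  define U where "U = (ball pbar \<delta>\<^sub>1 \<inter> D) \<times> ball xbar \<delta>\<^sub>2"
  have "openin (top_of_set (D \<times> UNIV)) U"
    unfolding U_def openin_open
    by (rule exI[of _ "ball pbar \<delta>\<^sub>1 \<times> ball xbar \<delta>\<^sub>2"]) (auto intro: open_Times)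
  moreover have "(pbar, xbar) \<in> U"
    using \<open>pbar \<in> D\<close> \<open>\<delta>\<^sub>1 > 0\<close> \<open>\<delta>\<^sub>2 > 0\<close> by (simp add: U_def)
  moreover have "set_dist w (feasible_set m n f g p) \<le> ereal (M * max_violation m n f g w p)"
    if "(p, w) \<in> U" for p w
  proof (cases "w \<in> feasible_set m n f g p")
    case True
    have "set_dist w (feasible_set m n f g p) \<le> ereal 0"
      using set_dist_le[OF True, of w] by simp
    also have "\<dots> \<le> ereal (M * max_violation m n f g w p)"
      using \<open>M > 0\<close> max_violation_nonneg[of m n f g w p] by simp
    finally show ?thesis .
  next
    case False
    moreover have "p \<in> ball pbar \<delta>\<^sub>1 \<inter> D" "w \<in> ball xbar \<delta>\<^sub>2"
      using that by (auto simp: U_def)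
    ultimately show ?thesis
      using assms(11) by (intro set_dist_feasible_set_le) blast+
  qed
  ultimately show ?thesis
    using \<open>M > 0\<close> unfolding R_regular_def max_violation_def[symmetric] by blast
qed

end
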